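(* The worst-case proportionality quality (the infimum over all approval profiles) of the rankings returned by Reverse Sequential PAV is $0$.
   Context: An approval profile consists of a set $N=\{1,\ldots,n\}$ of voters, a set $C$ of $m$ candidates, and approval ballots $A_i\subseteq C$ for $i\in N$, with $A_i\neq\emptyset$ for at least one voter $i$. For an integer $t\ge 0$, $H(t)=\sum_{j=1}^{t}1/j$ (so $H(0)=0$). For $S\subseteq C$, $\operatorname{PAV}(S)=\sum_{i\in N}H(|A_i\cap S|)$, and for $c\in S$ the marginal loss is $\Delta_S(c)=\operatorname{PAV}(S)-\operatorname{PAV}(S\setminus\{c\})$. Reverse Sequential PAV as a ranking rule: starting from the full candidate set $C$, repeatedly delete from the current set $S$ a candidate $c$ minimizing $\Delta_S(c)$ (ties resolved using a fixed priority linear order on candidates). The candidate deleted first is placed last in the ranking, the candidate deleted second is placed second-to-last, and so on. For a ranking $R$ of $C$ and $1\le k\le m$, $R_{\le k}$ denotes the set of the first $k$ candidates of $R$. For a non-empty group $V\subseteq N$ let $\lambda(V)=|\bigcap_{i\in V}A_i|$. The justifiable demand of $V$ for a prefix of length $k$ is $jd(V,k)=\min\{\lfloor |V|k/n\rfloor,\lambda(V)\}$, and its average satisfaction is $\operatorname{avg}_V(R_{\le k})=\frac{1}{|V|}\sum_{i\in V}|A_i\cap R_{\le k}|$. The proportionality quality of a ranking $R$ (for the given profile) is the minimum of $\operatorname{avg}_V(R_{\le k})/jd(V,k)$ over all $k$ and all groups $V$ with $jd(V,k)>0$. The worst-case proportionality quality of a ranking rule is the infimum of the proportionality quality of the ranking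 it returns, over all profiles (in which at least one pair $(V,k)$ with $jd(V,k)>0$ exists). *)

theory Defs
  imports "HOL-Analysis.Harmonic_Numbers"
begin

text \<open>
  Voters are the numbers in \<open>{1..n}\<close>, \<open>C\<close> is the set of candidates and \<open>A i\<close> is the ballot of
  voter \<open>i\<close>; values of \<open>A\<close> outside \<open>{1..n}\<close> are irrelevant.
\<close>

definition approval_profile :: "nat \<Rightarrow> 'c set \<Rightarrow> (nat \<Rightarrow> 'c set) \<Rightarrow> bool" where
  "approval_profile n C A \<longleftrightarrow>
     finite C \<and> (\<forall>i\<in>{1..n}. A i \<subseteq> C) \<and> (\<exists>i\<in>{1..n}. A i \<noteq> {})"

definition pav :: "nat \<Rightarrow> (nat \<Rightarrow> 'c set) \<Rightarrow> 'c set \<Rightarrow> real" where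
  "pav n A S = (\<Sum>i\<in>{1..n}. harm (card (A i \<inter> S)))"

definition marginal_loss :: "nat \<Rightarrow> (nat \<Rightarrow> 'c set) \<Rightarrow> 'c set \<Rightarrow> 'c \<Rightarrow> real" where
  "marginal_loss n A S c = pav n A S - pav n A (S - {c})"

definition loss_minimizers :: "nat \<Rightarrow> (nat \<Rightarrow> 'c set) \<Rightarrow> 'c set \<Rightarrow> 'c set" where
  "loss_minimizers n A S =
     {c \<in> S. \<forall>d\<in>S. marginal_loss n A S c \<le> marginal_loss n A S d}"

text \<open>
  Ties are broken by a linear order \<open>r\<close>, where \<open>(c, d) \<in> r\<close> means that \<open>d\<close> has at least the
  priority of \<open>c\<close>; among the minimizers the one of lowest priority is deleted.
\<close>

definition deleted_candidate :: "nat \<Rightarrow> (nat \<Rightarrow> 'c set) \<Rightarrow> 'c rel \<Rightarrow> 'c set \<Rightarrow> 'c" where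
  "deleted_candidate n A r S =
     (THE c. c \<in> loss_minimizers n A S \<and> (\<forall>d\<in>loss_minimizers n A S. (c, d) \<in> r))"

primrec remaining :: "nat \<Rightarrow> 'c set \<Rightarrow> (nat \<Rightarrow> 'c set) \<Rightarrow> 'c rel \<Rightarrow> nat \<Rightarrow> 'c set" where
  "remaining n C A r 0 = C"
| "remaining n C A r (Suc t) =
     remaining n C A r t - {deleted_candidate n A r (remaining n C A r t)}"

text \<open>
  A ranking is a list with the top candidate first.  A ranking rule maps \<open>n\<close>, \<open>C\<close> and \<open>A\<close> to a
  ranking of \<open>C\<close>.  The argument \<open>prio\<close> fixes one priority order for each candidate set.
\<close>

definition rev_seq_pav ::
  "('c set \<Rightarrow> 'c rel) \<Rightarrow> nat \<Rightarrow> 'c set \<Rightarrow> (nat \<Rightarrow> 'c set) \<Rightarrow> 'c list" where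
  "rev_seq_pav prio n C A =
     rev (map (\<lambda>t. deleted_candidate n A (prio C) (remaining n C A (prio C) t)) [0..<card C])"

definition top_candidates :: "'c list \<Rightarrow> nat \<Rightarrow> 'c set" where
  "top_candidates R k = set (take k R)"

definition cohesion :: "(nat \<Rightarrow> 'c set) \<Rightarrow> nat set \<Rightarrow> nat" where
  "cohesion A V = card (\<Inter>i\<in>V. A i)"

definition justifiable_demand :: "nat \<Rightarrow> (nat \<Rightarrow> 'c set) \<Rightarrow> nat set \<Rightarrow> nat \<Rightarrow> nat" where
  "justifiable_demand n A V k = min (card V * k div n) (cohesion A V)"

definition avg_satisfaction :: "(nat \<Rightarrow> 'c set) \<Rightarrow> nat set \<Rightarrow> 'c set \<Rightarrow> real" where
  "avg_satisfaction A V S = (\<Sum>i\<in>V. real (card (A i \<inter> S))) / real (card V)"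

definition demanding_pairs ::
  "nat \<Rightarrow> 'c set \<Rightarrow> (nat \<Rightarrow> 'c set) \<Rightarrow> (nat set \<times> nat) set" where
  "demanding_pairs n C A =
     {(V, k). V \<subseteq> {1..n} \<and> V \<noteq> {} \<and> k \<in> {1..card C} \<and> justifiable_demand n A V k > 0}"

text \<open>The set of demanding pairs is always finite, so \<open>Min\<close> is meaningful whenever it is nonempty.\<close>

definition proportionality_quality ::
  "nat \<Rightarrow> 'c set \<Rightarrow> (nat \<Rightarrow> 'c set) \<Rightarrow> 'c list \<Rightarrow> real" where
  "proportionality_quality n C A R =
     Min ((\<lambda>(V, k). avg_satisfaction A V (top_candidates R k)
                      / real (justifiable_demand n A V k)) ` demanding_pairs n C A)"

text \<open>
  All qualities are nonnegative.  The infimum ranges over all numbers of voters and all finite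
  candidate sets in \<open>'c\<close>, so \<open>'c\<close> has to be infinite for the number of candidates to be unbounded.
\<close>

definition worst_case_quality ::
  "(nat \<Rightarrow> 'c set \<Rightarrow> (nat \<Rightarrow> 'c set) \<Rightarrow> 'c list) \<Rightarrow> real" where
  "worst_case_quality rule =
     Inf {proportionality_quality n C A (rule n C A) | n C A.
            approval_profile n C A \<and> demanding_pairs n C A \<noteq> {}}"

end

theory Submission
  imports Defs
begin

text \<open>
  A single profile already has quality \<open>0\<close>. Six voters share a candidate \<open>x\<close>, and each of them also
  approves one private candidate, which has three further supporters. There are 24 more
  candidates with five supporters each, so \<open>n = 6 + 6 * 3 + 24 * 5 = 144\<close>. The initial losses are
  \<open>3\<close> for \<open>x\<close>, \<open>7/2\<close> for the private candidates and \<open>5\<close> for the others, so \<open>x\<close> goes first. This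
  raises the loss of the private candidates only to \<open>4\<close>, so they all go next. The six voters
  are then left without any approved candidate among the top \<open>24\<close>, although \<open>6 * 24 / 144 = 1\<close>.
\<close>

section \<open>Deletions\<close>

text \<open>Guarantees that the \<open>THE\<close> in \<open>deleted_candidate\<close> denotes an
  actual minimizer; uniqueness is antisymmetry.\<close>

lemma finite_linear_order_has_least:
  assumes "linear_order_on C r" "finite M" "M \<noteq> {}" "M \<subseteq> C"
  shows "\<exists>!c. c \<in> M \<and> (\<forall>d\<in>M. (c, d) \<in> r)"
proof -
  have r: "refl_on C r" "trans r" "antisym r" "total_on C r"
    using assms(1) by (auto simp: linear_order_on_def partial_order_on_def preorder_on_def)
  have "\<exists>c\<in>M. \<forall>d\<in>M. (c, d) \<in> r"
    using assms(2-4)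
  proof (induction M rule: finite_ne_induct)
    case (singleton x)
    then show ?case using r(1) by (auto simp: refl_on_def)
  next
    case (insert x F)
    then obtain c where c: "c \<in> F" "\<forall>d\<in>F. (c, d) \<in> r" by auto
    have refl: "(x, x) \<in> r" using insert.prems r(1) by (auto simp: refl_on_def)
    have "(c, x) \<in> r \<or> (x, c) \<in> r"
      using r(4) c(1) insert.prems insert.hyps by (auto simp: total_on_def)
    then show ?case
    proof
      assume "(c, x) \<in> r"
      then show ?thesis using c by auto
    next
      assume "(x, c) \<in> r"
      then have "\<forall>d\<in>F. (x, d) \<in> r" using c(2) r(2) by (meson transD)
      then show ?thesis using refl by auto
    qed
  qed
  then show ?thesis using r(3) by (metis antisymD)
qed

lemma loss_minimizers_nonempty:
  assumes "finite S" "S \<noteq> {}"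
  shows "loss_minimizers n A S \<noteq> {}"
proof -
  obtain c where "is_arg_min (marginal_loss n A S) (\<lambda>c. c \<in> S) c"
    using ex_is_arg_min_if_finite[OF assms] by blast
  then show ?thesis
    by (auto simp: is_arg_min_linorder loss_minimizers_def)
qed

lemma deleted_candidate_minimizes:
  assumes "linear_order_on C r" "finite S" "S \<noteq> {}" "S \<subseteq> C"
  shows "deleted_candidate n A r S \<in> loss_minimizers n A S"
proof -
  have sub: "loss_minimizers n A S \<subseteq> S" by (auto simp: loss_minimizers_def)
  have "\<exists>!c. c \<in> loss_minimizers n A S \<and> (\<forall>d\<in>loss_minimizers n A S. (c, d) \<in> r)"
    using assms sub finite_subset[OF sub]
    by (intro finite_linear_order_has_least[OF assms(1)] loss_minimizers_nonempty) auto
  from theI'[OF this] show ?thesis by (simp add: deleted_candidate_def)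
qed

lemma remaining_antimono:
  assumes "s \<le> t"
  shows "remaining n C A r t \<subseteq> remaining n C A r s"
  using assms by (induction t rule: dec_induct) auto

lemma remaining_subset: "remaining n C A r t \<subseteq> C"
  using remaining_antimono[of 0 t n C A r] by simp

text \<open>A deletion shrinks the set by one only if its candidate is present, and presence needs a
  non-empty set. Assuming positive cardinality in \<open>del\<close> breaks this circle.\<close>

lemma
  assumes "linear_order_on C r" "finite C" "t < card C"
  shows deleted_candidate_remaining:
      "deleted_candidate n A r (remaining n C A r t) \<in> remaining n C A r t"
    and card_remaining: "card (remaining n C A r t) = card C - t"
proof -
  have del: "deleted_candidate n A r (remaining n C A r t) \<in> remaining n C A r t"
    if "card (remaining n C A r t) > 0" for t
    using deleted_candidate_minimizes[OF assms(1) _ _ remaining_subset] that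
    by (fastforce simp: loss_minimizers_def card_gt_0_iff)
  show card: "card (remaining n C A r t) = card C - t"
    using assms(3)
  proof (induction t)
    case (Suc t)
    then show ?case using del[of t] by simp
  qed simp
  show "deleted_candidate n A r (remaining n C A r t) \<in> remaining n C A r t"
    using del card assms(3) by simp
qed

text \<open>The ranking lists deletions backwards, so the top \<open>k\<close> are the last
  \<open>k\<close> deletions, and each of these candidates is still present after
  \<open>card C - k\<close> steps.\<close>

lemma top_candidates_rev_seq_pav:
  assumes "linear_order_on C (prio C)" "finite C" "k \<le> card C"
  shows "top_candidates (rev_seq_pav prio n C A) k \<subseteq> remaining n C A (prio C) (card C - k)"
proof -
  let ?rem = "remaining n C A (prio C)"
  have "deleted_candidate n A (prio C) (?rem t) \<in> ?rem (card C - k)"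
    if "card C - k \<le> t" "t < card C" for t
    by (rule subsetD[OF remaining_antimono[OF that(1)] deleted_candidate_remaining[OF assms(1,2) that(2)]])
  then show ?thesis
    using assms(3) by (auto simp: top_candidates_def rev_seq_pav_def take_rev drop_map drop_upt)
qed

text \<open>A supporter with \<open>s\<close> approved candidates in \<open>S\<close> loses H(s) -
  H(s-1) = 1/s; all other voters lose nothing.\<close>

lemma marginal_loss_eq:
  assumes "finite S" "c \<in> S"
  shows "marginal_loss n A S c
           = (\<Sum>i\<in>{i\<in>{1..n}. c \<in> A i}. 1 / real (card (A i \<inter> S)))"
proof -
  have "harm (card (A i \<inter> S)) - harm (card (A i \<inter> (S - {c})))
          = (if c \<in> A i then 1 / real (card (A i \<inter> S)) else 0)" for i
  proof (cases "c \<in> A i")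
    case True
    have "A i \<inter> S = insert c (A i \<inter> (S - {c}))" using True assms(2) by auto
    moreover have "card (insert c (A i \<inter> (S - {c}))) = Suc (card (A i \<inter> (S - {c})))"
      using assms(1) by simp
    ultimately have "card (A i \<inter> S) = Suc (card (A i \<inter> (S - {c})))" by simp
    then show ?thesis using True by (simp add: harm_Suc inverse_eq_divide)
  next
    case False
    then have "A i \<inter> (S - {c}) = A i \<inter> S" by auto
    then show ?thesis using False by simp
  qed
  then have "marginal_loss n A S c
      = (\<Sum>i\<in>{1..n}. if c \<in> A i then 1 / real (card (A i \<inter> S)) else 0)"
    by (simp add: marginal_loss_def pav_def flip: sum_subtractf)
  also have "\<dots> = (\<Sum>i\<in>{i\<in>{1..n}. c \<in> A i}. 1 / real (card (A i \<inter> S)))"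
    by (rule sum.inter_filter[symmetric]) simp
  finally show ?thesis .
qed

section \<open>The quality is nonnegative\<close>

lemma finite_demanding_pairs: "finite (demanding_pairs n C A)"
  by (rule finite_subset[of _ "Pow {1..n} \<times> {1..card C}"]) (auto simp: demanding_pairs_def)

lemma proportionality_quality_nonneg:
  assumes "demanding_pairs n C A \<noteq> {}"
  shows "0 \<le> proportionality_quality n C A R"
  using assms finite_demanding_pairs[of n C A]
  by (auto simp: proportionality_quality_def avg_satisfaction_def intro!: divide_nonneg_nonneg sum_nonneg)

lemma proportionality_quality_eq_0:
  assumes "(V, k) \<in> demanding_pairs n C A"
    and "\<And>i. i \<in> V \<Longrightarrow> A i \<inter> top_candidates R k = {}"
  shows "proportionality_quality n C A R = 0"
proof (rule antisym)
  have "avg_satisfaction A V (top_candidates R k) = 0"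
    using assms(2) by (simp add: avg_satisfaction_def)
  then have "0 \<in> (\<lambda>(V, k). avg_satisfaction A V (top_candidates R k)
                      / real (justifiable_demand n A V k)) ` demanding_pairs n C A"
    using assms(1) by force
  then show "proportionality_quality n C A R \<le> 0"
    unfolding proportionality_quality_def by (intro Min_le finite_imageI finite_demanding_pairs)
  show "0 \<le> proportionality_quality n C A R"
    using assms(1) by (intro proportionality_quality_nonneg) auto
qed

section \<open>The bad profile\<close>

text \<open>Index \<open>0\<close> is the shared candidate, \<open>1, \<dots>, 6\<close> are the private ones.\<close>

definition bad_ballot :: "nat \<Rightarrow> nat set" where
  "bad_ballot i = (if i \<le> 6 then {0, i} else if i \<le> 24 then {(i - 4) div 3} else {(i + 10) div 5})"

text \<open>Inverts the integer divisions: voters 7 to 24 form blocks of three, voters 25 to 144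
  blocks of five. The extra \<open>j\<close> is the voter of the group who owns the private
  candidate \<open>j\<close>.\<close>

lemma bad_supporters:
  shows "{i\<in>{1..144}. 0 \<in> bad_ballot i} = {1..6}"
    and "j \<in> {1..6} \<Longrightarrow> {i\<in>{1..144}. j \<in> bad_ballot i} = insert j {3 * j + 4..3 * j + 6}"
    and "j \<in> {7..30} \<Longrightarrow> {i\<in>{1..144}. j \<in> bad_ballot i} = {5 * j - 10..5 * j - 6}"
  by (auto simp: bad_ballot_def split: if_splits)

lemma bad_ballot_bound: "i \<in> {1..144} \<Longrightarrow> bad_ballot i \<subseteq> {..30}"
  by (auto simp: bad_ballot_def)

text \<open>The profile is computed on indices and carried into an arbitrary candidate type by
  \<open>f\<close>; injectivity preserves the cardinalities that determine the losses.\<close>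

locale bad_profile =
  fixes f :: "nat \<Rightarrow> 'c"
  assumes inj: "inj f"
begin

abbreviation C :: "'c set" where "C \<equiv> f ` {..30}"
abbreviation A :: "nat \<Rightarrow> 'c set" where "A i \<equiv> f ` bad_ballot i"

lemma marginal_loss_image:
  assumes "finite S" "j \<in> S"
  shows "marginal_loss 144 A (f ` S) (f j)
           = (\<Sum>i\<in>{i\<in>{1..144}. j \<in> bad_ballot i}. 1 / real (card (bad_ballot i \<inter> S)))"
proof -
  have "card (A i \<inter> f ` S) = card (bad_ballot i \<inter> S)" for i
    by (simp add: image_Int[OF inj, symmetric] card_image inj_on_subset[OF inj])
  then show ?thesis
    using assms by (simp add: marginal_loss_eq inj_image_mem_iff[OF inj])
qed

lemma initial_loss:
  assumes "j \<le> 30"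
  shows "marginal_loss 144 A C (f j) = (if j = 0 then 3 else if j \<le> 6 then 7/2 else 5)"
proof -
  have Int: "bad_ballot i \<inter> {..30} = bad_ballot i" if "i \<in> {1..144}" for i
    using bad_ballot_bound[OF that] by auto
  have card: "card (bad_ballot i) = (if i \<le> 6 then 2 else 1)" if "i \<in> {1..144}" for i
    using that by (simp add: bad_ballot_def)
  have "marginal_loss 144 A C (f j)
          = (\<Sum>i\<in>{i\<in>{1..144}. j \<in> bad_ballot i}. if i \<le> 6 then 1/2 else 1)"
    using assms by (subst marginal_loss_image) (auto intro!: sum.cong simp: Int card)
  also have "\<dots> = (if j = 0 then 3 else if j \<le> 6 then 7/2 else 5)"
  proof -
    consider "j = 0" | "j \<in> {1..6}" | "j \<in> {7..30}" using assms by fastforce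
    then show ?thesis
    proof cases
      case 1
      then show ?thesis by (simp only: bad_supporters(1)) simp
    next
      case 2
      \<comment> \<open>Outside supporters have numbers from 7 on, hence weight 1; with the 1/2 of
        voter \<open>j\<close> the total is 7/2.\<close>
      have "(\<Sum>i\<in>{3 * j + 4..3 * j + 6}. if i \<le> 6 then 1/2 else 1 :: real)
              = (\<Sum>i\<in>{3 * j + 4..3 * j + 6}. 1)"
        using 2 by (intro sum.cong) auto
      then show ?thesis using 2 unfolding bad_supporters(2)[OF 2] by simp
    next
      case 3
      have "(\<Sum>i\<in>{5 * j - 10..5 * j - 6}. if i \<le> 6 then 1/2 else 1 :: real)
              = (\<Sum>i\<in>{5 * j - 10..5 * j - 6}. 1)"
        using 3 by (intro sum.cong) auto
      then show ?thesis using 3 unfolding bad_supporters(3)[OF 3] by simp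
    qed
  qed
  finally show ?thesis .
qed

text \<open>Once the shared candidate is gone, every ballot meets \<open>S\<close> in at most one
  candidate, so the loss just counts supporters, 1 + 3 or 5, whichever other candidates
  survive.\<close>

lemma later_loss:
  assumes "S \<subseteq> {1..30}" "j \<in> S"
  shows "marginal_loss 144 A (f ` S) (f j) = (if j \<le> 6 then 4 else 5)"
proof -
  have Int: "bad_ballot i \<inter> S = {j}" if "j \<in> bad_ballot i" for i
    using that assms by (auto simp: bad_ballot_def split: if_splits)
  have "marginal_loss 144 A (f ` S) (f j) = real (card {i\<in>{1..144}. j \<in> bad_ballot i})"
    using assms finite_subset[OF assms(1)] by (subst marginal_loss_image) (auto simp: Int)
  moreover have "j \<in> {1..6} \<or> j \<in> {7..30}" using assms by fastforce
  ultimately show ?thesis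
  proof (elim disjE)
    assume "j \<in> {1..6}"
    with \<open>marginal_loss 144 A (f ` S) (f j) = _\<close> show ?thesis
      by (simp only: bad_supporters(2)) simp
  next
    assume "j \<in> {7..30}"
    with \<open>marginal_loss 144 A (f ` S) (f j) = _\<close> show ?thesis
      by (simp only: bad_supporters(3)) simp
  qed
qed

text \<open>The private candidates tie, so their order of deletion depends on \<open>r\<close>; the
  invariant therefore records only the number of survivors.\<close>

lemma remaining_after_first_steps:
  assumes r: "linear_order_on C r" and "t \<le> 6"
  shows "\<exists>T \<subseteq> {1..6}. card T = 6 - t \<and> remaining 144 C A r (Suc t) = f ` (T \<union> {7..30})"
  using assms(2)
proof (induction t)
  case 0
  have "deleted_candidate 144 A r C \<in> loss_minimizers 144 A C"
    by (rule deleted_candidate_minimizes[OF r]) auto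
  then obtain j where j: "j \<le> 30" "deleted_candidate 144 A r C = f j"
    and "marginal_loss 144 A C (f j) \<le> marginal_loss 144 A C (f 0)"
    by (auto simp: loss_minimizers_def)
  \<comment> \<open>Loss 3 is strictly smallest, so the priority order has no say here.\<close>
  then have "j = 0" using initial_loss[of j] initial_loss[of 0] by (simp split: if_splits)
  then have "remaining 144 C A r (Suc 0) = f ` ({..30} - {0})"
    using j by (simp add: image_set_diff[OF inj])
  moreover have "{..30} - {0} = {1..6} \<union> {7..30::nat}" by auto
  ultimately show ?case by (intro exI[of _ "{1..6}"]) simp
next
  case (Suc t)
  then obtain T where T: "T \<subseteq> {1..6}" "card T = 6 - t"
    and rem: "remaining 144 C A r (Suc t) = f ` (T \<union> {7..30})" by auto
  have fin: "finite T" using T(1) finite_subset by blast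
  have "T \<noteq> {}" using T(2) Suc.prems by auto
  then obtain p where p: "p \<in> T" by auto
  let ?S = "T \<union> {7..30}"
  have S: "?S \<subseteq> {1..30}" using T(1) by auto
  have "deleted_candidate 144 A r (f ` ?S) \<in> loss_minimizers 144 A (f ` ?S)"
    using fin T(1) by (intro deleted_candidate_minimizes[OF r]) auto
  then obtain j where j: "j \<in> ?S" "deleted_candidate 144 A r (f ` ?S) = f j"
    and min: "\<forall>c\<in>f ` ?S. marginal_loss 144 A (f ` ?S) (f j) \<le> marginal_loss 144 A (f ` ?S) c"
    unfolding loss_minimizers_def mem_Collect_eq by (elim conjE imageE) metis
  \<comment> \<open>A surviving private candidate \<open>p\<close> has loss 4, which rules out
    deleting a candidate of loss 5.\<close>
  have "marginal_loss 144 A (f ` ?S) (f j) \<le> marginal_loss 144 A (f ` ?S) (f p)"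
    using min p by blast
  then have "j \<le> 6"
    using later_loss[OF S j(1)] later_loss[OF S, of p] p T(1) by (auto split: if_splits)
  then have jT: "j \<in> T" using j(1) by auto
  have "remaining 144 C A r (Suc (Suc t)) = f ` (?S - {j})"
    using rem j(2) by (simp only: remaining.simps(2)[of _ _ _ _ "Suc t"] image_set_diff[OF inj]) simp
  also have "?S - {j} = (T - {j}) \<union> {7..30}" using \<open>j \<le> 6\<close> by auto
  finally show ?case
    using T jT fin by (intro exI[of _ "T - {j}"]) auto
qed

lemma demanding: "({1..6}, 24) \<in> demanding_pairs 144 C A"
proof -
  have "(\<Inter>i\<in>{1..6}. A i) = {f 0}"
  proof
    \<comment> \<open>Two ballots suffice, as their private candidates differ.\<close>
    have "(\<Inter>i\<in>{1..6}. A i) \<subseteq> A 1 \<inter> A 2" by auto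
    also have "\<dots> \<subseteq> {f 0}" by (auto simp: bad_ballot_def inj_eq[OF inj])
    finally show "(\<Inter>i\<in>{1..6}. A i) \<subseteq> {f 0}" .
  qed (auto simp: bad_ballot_def)
  then have "cohesion A {1..6} = 1" by (simp add: cohesion_def)
  moreover have "card C = 31" by (simp add: card_image inj_on_subset[OF inj])
  ultimately show ?thesis by (simp add: demanding_pairs_def justifiable_demand_def)
qed

lemma approval: "approval_profile 144 C A"
proof -
  have "A 1 \<noteq> {}" by (simp add: bad_ballot_def)
  then show ?thesis using bad_ballot_bound by (fastforce simp: approval_profile_def)
qed

lemma quality_eq_0:
  assumes "linear_order_on C (prio C)"
  shows "proportionality_quality 144 C A (rev_seq_pav prio 144 C A) = 0"
proof (rule proportionality_quality_eq_0[OF demanding])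
  have card: "card C = 31" by (simp add: card_image inj_on_subset[OF inj])
  \<comment> \<open>The top 24 of 31 candidates are what is left after 7 deletions: the shared
    candidate and all six private ones.\<close>
  have "remaining 144 C A (prio C) 7 = f ` {7..30}"
  proof -
    obtain T where T: "T \<subseteq> {1..6}" "card T = 0"
      and rem: "remaining 144 C A (prio C) (Suc 6) = f ` (T \<union> {7..30})"
      using remaining_after_first_steps[OF assms, of 6] by auto
    have "T = {}" using T finite_subset[OF T(1)] by simp
    moreover have "Suc 6 = 7" by simp
    ultimately show ?thesis using rem by (simp only: Un_empty_left)
  qed
  then have top: "top_candidates (rev_seq_pav prio 144 C A) 24 \<subseteq> f ` {7..30}"
    using top_candidates_rev_seq_pav[of C prio 24 144 A] assms card by simp
  show "A i \<inter> top_candidates (rev_seq_pav prio 144 C A) 24 = {}" if "i \<in> {1..6}" for i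
  proof -
    have "A i \<inter> f ` {7..30} = {}"
      using that by (auto simp: bad_ballot_def inj_eq[OF inj])
    then show ?thesis using top by blast
  qed
qed

end

theorem corollary6:
  fixes prio :: "'c set \<Rightarrow> 'c rel"
  assumes "infinite (UNIV :: 'c set)"
    and "\<And>C. finite C \<Longrightarrow> linear_order_on C (prio C)"
  shows "worst_case_quality (rev_seq_pav prio) = 0"
proof -
  obtain f :: "nat \<Rightarrow> 'c" where "inj f"
    using infinite_countable_subset[OF assms(1)] by auto
  then interpret bad_profile f by unfold_locales
  have "proportionality_quality 144 C A (rev_seq_pav prio 144 C A) = 0"
    by (rule quality_eq_0) (rule assms(2), simp)
  then show ?thesis
    unfolding worst_case_quality_def
    \<comment> \<open>The infimum is attained: the bad profile has quality 0, and no quality is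
      negative.\<close>
    by (intro cInf_eq_minimum)
      (use approval demanding in \<open>force intro: proportionality_quality_nonneg\<close>)+
qed

end
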